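(* For complex $a,b,m,x$, $$\sum_{n=0}^{\infty}\frac{\Gamma(m+1)\,\bigl(xe^{-bx}\bigr)^n\;{}_1F_1(-n;\,m-n+1;\,-a-bn)}{n!\,\Gamma(m-n+1)}=\frac{e^{ax}(x+1)^m}{1-bx}.$$
   Context: $\Gamma$ is the Euler gamma function and ${}_1F_1(a;b;z)=\sum_{k\ge0}\frac{(a)_k}{(b)_k\,k!}z^k$ is the Kummer confluent hypergeometric function, with $(a)_k=a(a+1)\cdots(a+k-1)$.
   Formalization: False for unrestricted x (a=b=0, m=-1/2, x=2 diverges); x is required to satisfy |bx|<1, |bx e^{1-bx}|<1 and, if m is not a natural number and |b|<1, |x e^{-bx}|<|e^b|. Terms with m-n+1 in {0,-1,...} are limits in m; (x+1)^m is the principal power. *)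

theory Defs
  imports "HOL-Analysis.Analysis"
begin

definition kummer_1F1 :: "complex \<Rightarrow> complex \<Rightarrow> complex \<Rightarrow> complex" where
  "kummer_1F1 a b z = (\<Sum>k. pochhammer a k / (pochhammer b k * fact k) * z ^ k)"

definition summand :: "complex \<Rightarrow> complex \<Rightarrow> complex \<Rightarrow> complex \<Rightarrow> nat \<Rightarrow> complex" where
  "summand a b m x n =
     Gamma (m + 1) * (x * exp (- b * x)) ^ n
       * kummer_1F1 (- of_nat n) (m - of_nat n + 1) (- a - b * of_nat n)
     / (fact n * Gamma (m - of_nat n + 1))"

(* If m - n + 1 is a nonpositive integer, then Gamma has a pole there and the lower parameter of
   1F1 is inadmissible, so the term is meaningless as written (and the totalised library operations
   would give it an unrelated value). As a function of m it has a removable singularity at such a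
   point; its value there is the limit. Poles of Gamma (m + 1) are covered as well, because
   m + 1 in nonpos_Ints implies m - n + 1 in nonpos_Ints. *)
definition summand_ext :: "complex \<Rightarrow> complex \<Rightarrow> complex \<Rightarrow> complex \<Rightarrow> nat \<Rightarrow> complex" where
  "summand_ext a b m x n =
     (if m - of_nat n + 1 \<in> \<int>\<^sub>\<le>\<^sub>0 then Lim (at m) (\<lambda>\<mu>. summand a b \<mu> x n)
      else summand a b m x n)"

(* Principal branch, with z^0 = 1 also at z = 0 (the library has 0 powr 0 = 0). *)
definition cpow :: "complex \<Rightarrow> complex \<Rightarrow> complex" where
  "cpow z m = (if m = 0 then 1 else z powr m)"

(* The identity needs x to be restricted, even where the series converges: for a = m = 0, b = 1,
   x = 2 it converges to a value other than -1. The series is a power series in w = x exp(-bx), and the closed form is a function of the branch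
   x = x(w) with x(0) = 0. The first two conditions say that x lies in the image of that branch on
   the disc up to its branch point, which is x = 1/b, w = 1/(b e) (no condition if b = 0).
   The third keeps w inside the disc up to the singularity of (x + 1)^m at x = -1, w = -exp b.
   It is not needed if m is a natural number, or if norm b >= 1, where the first condition
   already gives norm x < 1; it follows from the second if x = -1 is not on the branch. *)
definition admissible :: "complex \<Rightarrow> complex \<Rightarrow> complex \<Rightarrow> bool" where
  "admissible b m x \<longleftrightarrow>
     norm (b * x) < 1 \<and>
     norm (b * x * exp (1 - b * x)) < 1 \<and>
     (m \<notin> \<nat> \<and> norm b < 1 \<longrightarrow> norm (x * exp (- b * x)) < norm (exp b))"

end

theory Submission
  imports Defs "HOL-Complex_Analysis.Complex_Analysis"
begin

text \<open>
  The \<open>n\<close>-th summand is \<open>w^n [t^n] f(t) e^(bnt)\<close> with \<open>w = x e^(-bx)\<close> and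
  \<open>f(t) = e^(at) (1+t)^m\<close>, so the identity is an instance of Lagrange inversion. For small \<open>|bw|\<close>
  the map \<open>t \<mapsto> w e^(bt)\<close> is a contraction of \<open>|bt| \<le> 1\<close>, so \<open>t e^(-bt)\<close> has a holomorphic
  inverse \<open>\<phi>\<close> on a disc around \<open>0\<close> which contains \<open>w\<close>. On that disc \<open>1 + \<phi>\<close> avoids the cut of the
  principal power if \<open>m\<close> is not a natural number, so \<open>H = f(\<phi>) / (1 - b \<phi>)\<close> is holomorphic and its
  Taylor series at \<open>0\<close> converges to it on the whole disc. Comparing formal power series in
  \<open>H(t e^(-bt)) (1 - bt) = f(t)\<close> identifies the Taylor coefficients of \<open>H\<close>.
\<close>

lemma fps_mult_compose_nth:
  fixes D h G :: "'a :: comm_ring_1 fps"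
  assumes "fps_nth G 0 = 0"
  shows "fps_nth (D * (h oo G)) n = (\<Sum>k\<le>n. fps_nth h k * fps_nth (D * G ^ k) n)"
proof -
  have "fps_nth (D * (h oo G)) n = (\<Sum>i\<le>n. fps_nth (h oo G) i * fps_nth D (n - i))"
    by (subst mult.commute) (simp add: fps_mult_nth atMost_atLeast0)
  also have "\<dots> = (\<Sum>i\<le>n. (\<Sum>k\<le>n. fps_nth h k * fps_nth (G ^ k) i) * fps_nth D (n - i))"
  proof (intro sum.cong refl arg_cong2[where f = "(*)"])
    fix i assume i: "i \<in> {..n}"
    have "fps_nth (h oo G) i = (\<Sum>k\<le>i. fps_nth h k * fps_nth (G ^ k) i)"
      by (simp add: fps_compose_nth atMost_atLeast0)
    also have "\<dots> = (\<Sum>k\<le>n. fps_nth h k * fps_nth (G ^ k) i)"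
      using i startsby_zero_power_prefix[OF assms] by (intro sum.mono_neutral_left) auto
    finally show "fps_nth (h oo G) i = (\<Sum>k\<le>n. fps_nth h k * fps_nth (G ^ k) i)" .
  qed
  also have "\<dots> = (\<Sum>i\<le>n. \<Sum>k\<le>n. fps_nth h k * (fps_nth (G ^ k) i * fps_nth D (n - i)))"
    by (simp add: sum_distrib_right mult.assoc)
  also have "\<dots> = (\<Sum>k\<le>n. \<Sum>i\<le>n. fps_nth h k * (fps_nth (G ^ k) i * fps_nth D (n - i)))"
    by (rule sum.swap)
  also have "\<dots> = (\<Sum>k\<le>n. fps_nth h k * fps_nth (G ^ k * D) n)"
    by (simp add: fps_mult_nth atMost_atLeast0 sum_distrib_left)
  finally show ?thesis
    by (simp add: mult.commute)
qed

lemma fps_exp_Lagrange_nth: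
  fixes b :: "'a :: field_char_0" and h :: "'a fps"
  assumes F: "F = (1 - fps_const b * fps_X) * (h oo (fps_X * fps_exp (- b)))"
  shows "fps_nth (fps_exp (b * of_nat n) * F) n = fps_nth h n"
proof -
  define D where "D = fps_exp (b * of_nat n) * (1 - fps_const b * fps_X)"
  have nth: "fps_nth (D * (fps_X * fps_exp (- b)) ^ k) n = (if k = n then 1 else 0)"
    if "k \<le> n" for k
  proof -
    define c where "c = b * of_nat (n - k)"
    have "fps_exp (b * of_nat n) * fps_exp (- b) ^ k = fps_exp c"
      using that
      by (simp add: fps_exp_power_mult c_def algebra_simps flip: fps_exp_add_mult)
    then have "D * (fps_X * fps_exp (- b)) ^ k
        = fps_X ^ k * (fps_exp c - fps_X * (fps_const b * fps_exp c))"
      unfolding D_def power_mult_distrib by (simp add: algebra_simps)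
    then have "fps_nth (D * (fps_X * fps_exp (- b)) ^ k) n
        = fps_nth (fps_exp c - fps_X * (fps_const b * fps_exp c)) (n - k)"
      using that by (simp add: fps_X_power_mult_nth)
    also have "\<dots> = (if k = n then 1 else 0)"
    proof (cases "n - k")
      case 0
      then show ?thesis using that by simp
    next
      case (Suc j)
      have "c ^ Suc j / fact (Suc j) = b * c ^ j / fact j"
        by (simp add: c_def Suc del: of_nat_Suc)
      then show ?thesis using that Suc by (auto simp del: power_Suc fact_Suc)
    qed
    finally show ?thesis .
  qed
  have "fps_exp (b * of_nat n) * F = D * (h oo (fps_X * fps_exp (- b)))"
    by (simp add: F D_def mult.assoc)
  then have "fps_nth (fps_exp (b * of_nat n) * F) n
      = (\<Sum>k\<le>n. fps_nth h k * fps_nth (D * (fps_X * fps_exp (- b)) ^ k) n)"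
    by (simp add: fps_mult_compose_nth)
  also have "\<dots> = (\<Sum>k\<le>n. if k = n then fps_nth h k else 0)"
    by (intro sum.cong) (auto simp: nth)
  finally show ?thesis by simp
qed

definition lagrange_coeff :: "complex \<Rightarrow> complex \<Rightarrow> complex \<Rightarrow> nat \<Rightarrow> complex" where
  "lagrange_coeff a b m n = (\<Sum>k\<le>n. (a + b * of_nat n) ^ k / fact k * (m gchoose (n - k)))"

lemma lagrange_coeff_eq_fps_nth:
  "lagrange_coeff a b m n = fps_nth (fps_exp (b * of_nat n) * (fps_exp a * fps_binomial m)) n"
proof -
  have "fps_exp (b * of_nat n) * (fps_exp a * fps_binomial m)
      = fps_exp (a + b * of_nat n) * fps_binomial m"
    by (simp add: fps_exp_add_mult mult_ac)
  then show ?thesis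
    by (simp only: fps_mult_nth[of "fps_exp (a + b * of_nat n)"])
       (simp add: lagrange_coeff_def atMost_atLeast0)
qed

lemma kummer_1F1_neg_of_nat:
  "kummer_1F1 (- of_nat n) c z = (\<Sum>k\<le>n. of_nat (n choose k) * (- z) ^ k / pochhammer c k)"
proof -
  have "pochhammer (- of_nat n :: complex) k = fact k * (- 1) ^ k * of_nat (n choose k)" for k
    by (simp add: binomial_gbinomial gbinomial_pochhammer)
  then have "kummer_1F1 (- of_nat n) c z
      = (\<Sum>k. of_nat (n choose k) * (- z) ^ k / pochhammer c k)"
    unfolding kummer_1F1_def by (intro suminf_cong) (simp add: field_simps power_minus[of z])
  also have "\<dots> = (\<Sum>k\<le>n. of_nat (n choose k) * (- z) ^ k / pochhammer c k)"
    by (intro suminf_finite) auto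
  finally show ?thesis .
qed

lemma summand_eq_lagrange_coeff:
  assumes "m - of_nat n + 1 \<notin> \<int>\<^sub>\<le>\<^sub>0"
  shows "summand a b m x n = lagrange_coeff a b m n * (x * exp (- b * x)) ^ n"
proof -
  define c where "c = m - of_nat n + 1"
  have "Gamma (m + 1) / Gamma c
        * (of_nat (n choose k) * (a + b * of_nat n) ^ k / pochhammer c k) / fact n
      = (a + b * of_nat n) ^ k / fact k * (m gchoose (n - k))" if "k \<le> n" for k
  proof -
    have "Gamma (m + 1) / Gamma c = pochhammer c n"
      using pochhammer_Gamma[of c n] assms by (simp add: c_def)
    also have "\<dots> = pochhammer c k * pochhammer (c + of_nat k) (n - k)"
      using that by (rule pochhammer_product)
    finally have 1: "Gamma (m + 1) / Gamma c = pochhammer c k * pochhammer (c + of_nat k) (n - k)" .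
    have 2: "m gchoose (n - k) = pochhammer (c + of_nat k) (n - k) / fact (n - k)"
      using that by (simp add: gbinomial_pochhammer' c_def algebra_simps)
    have 3: "of_nat (n choose k) = (fact n / (fact k * fact (n - k)) :: complex)"
      using that by (rule binomial_fact)
    have 4: "pochhammer c k \<noteq> 0"
      using assms unfolding c_def[symmetric] by (auto simp: pochhammer_eq_0_iff)
    show ?thesis
      unfolding 1 2 3 using 4 by (simp add: field_simps)
  qed
  then have "lagrange_coeff a b m n = Gamma (m + 1) / Gamma c
      * (\<Sum>k\<le>n. of_nat (n choose k) * (a + b * of_nat n) ^ k / pochhammer c k) / fact n"
    unfolding lagrange_coeff_def sum_distrib_left sum_divide_distrib by (intro sum.cong) auto
  moreover have "- (- a - b * of_nat n) = a + b * of_nat n" by simp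
  ultimately show ?thesis
    unfolding summand_def kummer_1F1_neg_of_nat c_def[symmetric] by (simp add: ac_simps)
qed

lemma eventually_diff_notin_nonpos_Ints:
  fixes m c :: complex
  assumes "m - c \<in> \<int>\<^sub>\<le>\<^sub>0"
  shows "eventually (\<lambda>\<mu>. \<mu> - c \<notin> \<int>\<^sub>\<le>\<^sub>0) (at m)"
  unfolding eventually_at
proof (intro exI[of _ 1] conjI ballI impI)
  fix \<mu> assume \<mu>: "\<mu> \<noteq> m \<and> dist \<mu> m < 1"
  show "\<mu> - c \<notin> \<int>\<^sub>\<le>\<^sub>0"
  proof
    assume "\<mu> - c \<in> \<int>\<^sub>\<le>\<^sub>0"
    then obtain i j where ij: "\<mu> - c = of_int i" "m - c = of_int j"
      using assms by (auto elim!: nonpos_Ints_cases)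
    then have *: "\<mu> - m = of_int (i - j)"
      by (metis diff_diff_eq2 diff_add_cancel of_int_diff)
    have "norm (\<mu> - m) = of_int \<bar>i - j\<bar>"
      unfolding * norm_of_int by simp
    with \<mu> have "\<bar>i - j\<bar> < 1" by (metis dist_norm of_int_less_1_iff)
    then have "i = j" by simp
    with * \<mu> show False by simp
  qed
qed auto

lemma summand_ext_eq_lagrange_coeff:
  "summand_ext a b m x n = lagrange_coeff a b m n * (x * exp (- b * x)) ^ n"
proof (cases "m - of_nat n + 1 \<in> \<int>\<^sub>\<le>\<^sub>0")
  case True
  let ?f = "\<lambda>\<mu>. lagrange_coeff a b \<mu> n * (x * exp (- b * x)) ^ n"
  have "isCont ?f m"
    unfolding lagrange_coeff_def gbinomial_prod_rev by (intro continuous_intros) auto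
  then have "(?f \<longlongrightarrow> ?f m) (at m)"
    by (rule isContD)
  moreover have "eventually (\<lambda>\<mu>. ?f \<mu> = summand a b \<mu> x n) (at m)"
    using eventually_diff_notin_nonpos_Ints[of m "of_nat n - 1"] True
    by (auto elim!: eventually_mono simp: summand_eq_lagrange_coeff algebra_simps)
  ultimately have "((\<lambda>\<mu>. summand a b \<mu> x n) \<longlongrightarrow> ?f m) (at m)"
    by (rule Lim_transform_eventually)
  then show ?thesis
    using True by (simp add: summand_ext_def tendsto_Lim)
qed (simp add: summand_ext_def summand_eq_lagrange_coeff)

lemma cpow_of_nat: "cpow z (of_nat k) = z ^ k"
  by (cases "k = 0") (auto simp: cpow_def powr_nat')

lemma cpow_holomorphic:
  assumes "m \<notin> \<nat> \<Longrightarrow> (\<And>t. t \<in> A \<Longrightarrow> t + 1 \<notin> \<real>\<^sub>\<le>\<^sub>0)"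
  shows "(\<lambda>t. cpow (t + 1) m) holomorphic_on A"
proof (cases "m \<in> \<nat>")
  case True
  then obtain k where "m = of_nat k" by (auto elim: Nats_cases)
  then show ?thesis by (auto simp: cpow_of_nat intro!: holomorphic_intros)
next
  case False
  then have "m \<noteq> 0" by auto
  with False assms show ?thesis by (auto simp: cpow_def intro!: holomorphic_intros)
qed

lemma cpow_has_fps_expansion: "(\<lambda>t. cpow (t + 1) m) has_fps_expansion fps_binomial m"
proof -
  have "eventually (\<lambda>t. t \<in> - {-1 :: complex}) (nhds 0)"
    by (rule eventually_nhds_in_open) auto
  then have "eventually (\<lambda>t. (1 + t) powr m = cpow (t + 1) m) (nhds 0)"
    by eventually_elim (auto simp: cpow_def add.commute[of 1] add_eq_0_iff2)
  from has_fps_expansion_cong[OF this refl] show ?thesis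
    using has_fps_expansion_binomial_complex[of m] by simp
qed

lemma add_1_notin_nonpos_Reals:
  fixes b t :: complex
  assumes "norm (b * t) < 1" and "norm b < 1 \<Longrightarrow> norm (t * exp (- b * t)) < norm (exp b)"
  shows "t + 1 \<notin> \<real>\<^sub>\<le>\<^sub>0"
proof
  assume "t + 1 \<in> \<real>\<^sub>\<le>\<^sub>0"
  then obtain r where "t + 1 = of_real r" "r \<le> 0"
    by (auto elim: nonpos_Reals_cases)
  then obtain s :: real where s: "t = of_real (- s)" "s \<ge> 1"
    by (intro that[of "1 - r"]) (auto simp: algebra_simps)
  have bs: "norm b * s < 1"
    using assms(1) s by (simp add: norm_mult)
  have "norm b * 1 \<le> norm b * s"
    using s by (intro mult_left_mono) auto
  with bs have "norm b < 1" by simp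
  from assms(2)[OF this] have "s * exp (s * Re b) < exp (Re b)"
    using s by (simp add: norm_mult mult.commute)
  then have "ln (s * exp (s * Re b)) < Re b"
    using s by (simp add: ln_less_cancel_iff[of _ "exp (Re b)", simplified])
  then have 1: "ln s + s * Re b < Re b"
    using s by (simp add: ln_mult)
  have 2: "1 - 1 / s \<le> ln s"
    using ln_le_minus_one[of "1 / s"] s by (simp add: ln_div)
  have "norm b \<le> 1 / s"
    using bs s by (simp add: field_simps)
  then have "- Re b \<le> 1 / s"
    using abs_Re_le_cmod[of b] by linarith
  then have "- Re b * (s - 1) \<le> 1 / s * (s - 1)"
    using s by (intro mult_right_mono) auto
  also have "\<dots> = 1 - 1 / s"
    using s by (simp add: field_simps)
  finally show False
    using 1 2 by (simp add: algebra_simps)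
qed

lemma mult_exp_fixed_point:
  fixes b w :: complex
  assumes "norm (b * w) * exp 1 < 1"
  shows "\<exists>!t. t \<in> {t. norm (b * t) \<le> 1} \<and> w * exp (b * t) = t"
proof -
  let ?S = "{t. norm (b * t) \<le> 1}"
  have exp_le: "norm (exp (b * t)) \<le> exp 1" if "t \<in> ?S" for t
    using that complex_Re_le_cmod[of "b * t"] by auto
  have "closed ?S"
    by (intro closed_Collect_le continuous_intros)
  have "convex ?S"
  proof -
    have "?S = (*) b -` cball 0 1" by (auto simp: dist_norm)
    then show ?thesis
      by (simp add: convex_linear_vimage del: vimage_Collect_eq)
  qed
  show ?thesis
  proof (rule Banach_fix[where c = "norm (b * w) * exp 1"])
    show "complete ?S" using \<open>closed ?S\<close> by (simp add: complete_eq_closed)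
    show "?S \<noteq> {}" by (auto intro: exI[of _ 0])
    show "(\<lambda>t. w * exp (b * t)) ` ?S \<subseteq> ?S"
    proof safe
      fix t assume "norm (b * t) \<le> 1"
      then have "norm (b * w) * norm (exp (b * t)) \<le> norm (b * w) * exp 1"
        using exp_le by (intro mult_left_mono) auto
      then show "norm (b * (w * exp (b * t))) \<le> 1"
        using assms by (simp add: norm_mult mult.assoc)
    qed
    fix s t assume st: "s \<in> ?S" "t \<in> ?S"
    have "norm (w * exp (b * s) - w * exp (b * t)) \<le> norm (b * w) * exp 1 * norm (s - t)"
    proof (rule field_differentiable_bound[OF \<open>convex ?S\<close>])
      fix z assume z: "z \<in> ?S"
      show "((\<lambda>t. w * exp (b * t)) has_field_derivative b * w * exp (b * z)) (at z within ?S)"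
        by (auto intro!: derivative_eq_intros)
      show "norm (b * w * exp (b * z)) \<le> norm (b * w) * exp 1"
        unfolding norm_mult[of "b * w"] by (intro mult_left_mono exp_le z) auto
    qed (use st in auto)
    then show "dist (w * exp (b * s)) (w * exp (b * t)) \<le> norm (b * w) * exp 1 * dist s t"
      by (simp add: dist_norm)
  qed (use assms in auto)
qed

lemma mult_exp_minus_eq_iff: "t * exp (- b * t) = w \<longleftrightarrow> w * exp (b * t) = (t :: complex)"
  by (auto simp: exp_minus field_simps)

lemma mult_exp_minus_inverse:
  fixes b :: complex and \<rho> :: real
  assumes "norm b * \<rho> * exp 1 \<le> 1"
  defines "g \<equiv> \<lambda>t. t * exp (- b * t)"
  defines "D \<equiv> {t. norm (b * t) < 1 \<and> norm (g t) < \<rho>}"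
  obtains \<phi> where "\<phi> holomorphic_on ball 0 \<rho>" "\<And>t. t \<in> D \<Longrightarrow> \<phi> (g t) = t"
    "\<And>w. w \<in> ball 0 \<rho> \<Longrightarrow> \<phi> w \<in> D"
proof -
  have small: "norm (b * w) * exp 1 < 1" if "norm w < \<rho>" for w
  proof (cases "b = 0")
    case False
    then have "norm b * norm w * exp 1 < norm b * \<rho> * exp 1" using that by simp
    then show ?thesis using assms(1) by (simp add: norm_mult)
  qed auto
  have "g holomorphic_on D"
    unfolding g_def by (intro holomorphic_intros)
  moreover have "open D"
    unfolding D_def g_def by (intro open_Collect_conj open_Collect_less continuous_intros)
  moreover have "inj_on g D"
  proof (rule inj_onI)
    fix s t assume st: "s \<in> D" "t \<in> D" "g s = g t"
    then have "norm (b * g t) * exp 1 < 1" by (intro small) (auto simp: D_def)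
    then obtain u where u: "\<And>v. norm (b * v) \<le> 1 \<Longrightarrow> g t * exp (b * v) = v \<Longrightarrow> v = u"
      using mult_exp_fixed_point[of b "g t"] by auto
    have "g t * exp (b * s) = s" "g t * exp (b * t) = t"
      using st(3) by (metis g_def mult_exp_minus_eq_iff)+
    then show "s = t"
      using u[of s] u[of t] st(1,2) by (simp add: D_def)
  qed
  ultimately obtain \<phi> where \<phi>: "\<phi> holomorphic_on g ` D" "\<And>t. t \<in> D \<Longrightarrow> \<phi> (g t) = t"
    using holomorphic_has_inverse by metis
  have "ball 0 \<rho> \<subseteq> g ` D"
  proof
    fix w :: complex assume "w \<in> ball 0 \<rho>"
    then have w: "norm w < \<rho>" by simp
    obtain t where t: "norm (b * t) \<le> 1" "w * exp (b * t) = t"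
      using mult_exp_fixed_point[OF small[OF w]] by auto
    have "norm (b * w) * norm (exp (b * t)) \<le> norm (b * w) * exp 1"
      using t(1) complex_Re_le_cmod[of "b * t"] by (intro mult_left_mono) auto
    then have "norm (b * (w * exp (b * t))) < 1"
      using small[OF w] by (simp add: norm_mult mult.assoc)
    then have "norm (b * t) < 1" using t(2) by simp
    moreover have "g t = w" using t(2) unfolding g_def mult_exp_minus_eq_iff .
    ultimately show "w \<in> g ` D" using w by (auto simp: D_def)
  qed
  with \<phi> show thesis
    by (intro that[of \<phi>] holomorphic_on_subset[OF \<phi>(1)]) auto
qed

lemma admissible_obtain_radius:
  assumes "admissible b m x"
  obtains \<rho> where "norm (x * exp (- b * x)) < \<rho>" "norm b * \<rho> * exp 1 < 1"
    "m \<notin> \<nat> \<Longrightarrow> norm b < 1 \<Longrightarrow> \<rho> < norm (exp b)"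
proof -
  define r where "r = norm (x * exp (- b * x))"
  have "b * x * exp (1 - b * x) = b * (x * exp (- b * x)) * exp 1"
    by (simp add: exp_diff exp_minus field_simps)
  then have "norm b * r * exp 1 < 1"
    using assms unfolding admissible_def r_def by (metis norm_exp_eq_Re norm_mult one_complex.simps(1))
  moreover have "((\<lambda>\<rho>. norm b * \<rho> * exp 1) \<longlongrightarrow> norm b * r * exp 1) (at_right r)"
    by (intro tendsto_intros)
  ultimately have 1: "eventually (\<lambda>\<rho>. norm b * \<rho> * exp 1 < 1) (at_right r)"
    by (rule order_tendstoD(2)[rotated])
  have 2: "eventually (\<lambda>\<rho>. m \<notin> \<nat> \<and> norm b < 1 \<longrightarrow> \<rho> < norm (exp b)) (at_right r)"
  proof (cases "m \<notin> \<nat> \<and> norm b < 1")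
    case True
    then have "r < norm (exp b)" using assms by (auto simp: admissible_def r_def)
    then show ?thesis
      using order_tendstoD(2)[OF tendsto_ident_at] by (auto elim: eventually_mono)
  qed auto
  have "eventually (\<lambda>\<rho>. r < \<rho>) (at_right r)"
    by (rule eventually_at_right_less)
  with 1 2 have "eventually (\<lambda>\<rho>. r < \<rho> \<and> norm b * \<rho> * exp 1 < 1 \<and>
      (m \<notin> \<nat> \<and> norm b < 1 \<longrightarrow> \<rho> < norm (exp b))) (at_right r)"
    by eventually_elim auto
  then show thesis
    using that eventually_happens'[OF trivial_limit_at_right_real] unfolding r_def by blast
qed

theorem proposition3p12:
  fixes a b m x :: complex
  assumes "admissible b m x"
  shows "(\<lambda>n. summand_ext a b m x n) sums (exp (a * x) * cpow (x + 1) m / (1 - b * x))"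
proof -
  obtain \<rho> where \<rho>: "norm (x * exp (- b * x)) < \<rho>" "norm b * \<rho> * exp 1 < 1"
    "m \<notin> \<nat> \<Longrightarrow> norm b < 1 \<Longrightarrow> \<rho> < norm (exp b)"
    using admissible_obtain_radius[OF assms] by blast
  define g where "g = (\<lambda>t. t * exp (- b * t))"
  define D where "D = {t. norm (b * t) < 1 \<and> norm (g t) < \<rho>}"
  define f where "f = (\<lambda>t. exp (a * t) * cpow (t + 1) m)"
  obtain \<phi> where \<phi>: "\<phi> holomorphic_on ball 0 \<rho>" "\<And>t. t \<in> D \<Longrightarrow> \<phi> (g t) = t"
    "\<And>w. w \<in> ball 0 \<rho> \<Longrightarrow> \<phi> w \<in> D"
    using mult_exp_minus_inverse[of b \<rho>] \<rho>(2) unfolding g_def D_def by auto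
  have ne: "b * t \<noteq> 1" if "t \<in> D" for t
    using that by (auto simp: D_def)
  have "x \<in> D" "0 < \<rho>"
    using assms \<rho>(1) norm_ge_zero[of "x * exp (- b * x)"]
    by (auto simp: D_def g_def admissible_def simp del: norm_ge_zero)
  then have "0 \<in> D" by (simp add: D_def g_def)
  define H where "H = (\<lambda>w. f (\<phi> w) / (1 - b * \<phi> w))"
  have "(\<lambda>t. cpow (t + 1) m) holomorphic_on D"
  proof (rule cpow_holomorphic)
    fix t assume "m \<notin> \<nat>" "t \<in> D"
    then show "t + 1 \<notin> \<real>\<^sub>\<le>\<^sub>0"
      using \<rho>(3) by (intro add_1_notin_nonpos_Reals[of b]) (auto simp: D_def g_def)
  qed
  then have "(\<lambda>t. f t / (1 - b * t)) holomorphic_on D"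
    unfolding f_def using ne by (intro holomorphic_intros) auto
  then have "((\<lambda>t. f t / (1 - b * t)) \<circ> \<phi>) holomorphic_on ball 0 \<rho>"
    using \<phi> by (intro holomorphic_on_compose_gen) auto
  then have holo: "H holomorphic_on ball 0 \<rho>"
    by (simp add: H_def o_def)
  define h where "h = fps_expansion H 0"
  have "fps_nth h n = lagrange_coeff a b m n" for n
  proof -
    have "H has_fps_expansion h"
      unfolding h_def using holo \<open>0 < \<rho>\<close> by (intro has_fps_expansion_fps_expansion[of "ball 0 \<rho>"]) auto
    moreover have "g has_fps_expansion fps_X * fps_exp (- b)"
      unfolding g_def by (intro fps_expansion_intros)
    ultimately have Hg: "(H \<circ> g) has_fps_expansion (h oo (fps_X * fps_exp (- b)))"
      by (intro has_fps_expansion_compose) auto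
    have "(\<lambda>t. (1 - b * t) * (H \<circ> g) t) has_fps_expansion
        (1 - fps_const b * fps_X) * (h oo (fps_X * fps_exp (- b)))"
      by (intro fps_expansion_intros Hg)
    moreover have "open D"
      unfolding D_def g_def by (intro open_Collect_conj open_Collect_less continuous_intros)
    then have "eventually (\<lambda>t. t \<in> D) (nhds 0)"
      using \<open>0 \<in> D\<close> by (rule eventually_nhds_in_open)
    then have "eventually (\<lambda>t. (1 - b * t) * (H \<circ> g) t = f t) (nhds 0)"
      by eventually_elim (use ne in \<open>auto simp: H_def \<phi>(2)\<close>)
    note has_fps_expansion_cong[OF this refl]
    ultimately have "f has_fps_expansion (1 - fps_const b * fps_X) * (h oo (fps_X * fps_exp (- b)))"
      by simp
    moreover have "f has_fps_expansion fps_exp a * fps_binomial m"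
      unfolding f_def by (intro fps_expansion_intros cpow_has_fps_expansion)
    ultimately show ?thesis
      using fps_exp_Lagrange_nth fps_expansion_unique_complex lagrange_coeff_eq_fps_nth by metis
  qed
  moreover have "g x \<in> ball 0 \<rho>" using \<rho>(1) by (simp add: g_def)
  from holomorphic_power_series[OF holo this]
  have "(\<lambda>n. fps_nth h n * g x ^ n) sums H (g x)"
    by (simp add: h_def fps_expansion_def)
  moreover have "H (g x) = f x / (1 - b * x)"
    using \<open>x \<in> D\<close> by (simp add: H_def \<phi>(2))
  ultimately show ?thesis
    by (simp add: summand_ext_eq_lagrange_coeff g_def f_def)
qed

end
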